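(* Let $n,p\geqslant 1$ and $1\leqslant k\leqslant p$ be integers, let $\gamma>0$, let $x_1,\dots,x_n\in\mathbb{R}^p$ and $y_1,\dots,y_n\in\{-1,1\}$, and let $\ell:\{-1,1\}\times\mathbb{R}\to\mathbb{R}$ be a loss function such that $\ell(y,\cdot)$ is convex for each $y\in\{-1,1\}$. Let $X\in\mathbb{R}^{n\times p}$ be the matrix with rows $x_i^\top$ and let $X_j\in\mathbb{R}^n$ denote its $j$-th column. Then the problem $$\text{(P)}\qquad \min_{w\in\mathbb{R}^p,\,b\in\mathbb{R}}\ \sum_{i=1}^n\ell(y_i,w^\top x_i+b)+\frac1{2\gamma}\|w\|_2^2\quad\text{s.t.}\quad\|w\|_0\leqslant k$$ is equivalent to $$\text{(Q)}\qquad \min_{s\in S_k^p}c(s),$$ where $$c(s):=\max_{\alpha\in\mathbb{R}^n:\ \mathbf{e}^\top\alpha=0} f(\alpha,s),\qquad f(\alpha,s):=-\sum_{i=1}^n\hat\ell(y_i,\alpha_i)-\frac{\gamma}{2}\sum_{j=1}^p s_j\,\alpha^\top X_jX_j^\top\alpha .$$ In particular, $c$ (defined by the same formula for $s\in[0,1]^p$) is convex over $[0,1]^p$.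
   Context: $\|w\|_0$ is the number of nonzero entries of $w$; $\mathbf{e}$ is the all-ones vector; $S_k^p:=\{s\in\{0,1\}^p:\mathbf{e}^\top s\leqslant k\}$. The Fenchel conjugate of the loss is $\hat\ell(y,\alpha):=\max_{u\in\mathbb{R}}\,(u\alpha-\ell(y,u))\in\mathbb{R}\cup\{+\infty\}$. Throughout, $\min$ and $\max$ denote optimal values in the extended reals (infimum/supremum when not attained), and convexity of $c$ is understood for extended-real-valued functions. "Equivalent" means that (P) and (Q) have the same optimal value, and that $s\in S_k^p$ encodes the support of $w$ in (P): if $(w,b)$ is optimal for (P), then the indicator vector of the support of $w$ is optimal for (Q); and if $s$ is optimal for (Q), then any minimizer $(w,b)$ of the objective of (P) over all $(w,b)$ with $w_j=0$ whenever $s_j=0$ is optimal for (P). *)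

theory Defs
  imports "HOL-Analysis.Analysis"
begin

text \<open>
  The dimensions are types: samples are indexed by \<open>'n\<close> and features by \<open>'p\<close>, so
  \<open>CARD('n)\<close> and \<open>CARD('p)\<close> are arbitrary positive integers.  The loss
  \<open>loss y\<close> only matters for labels \<open>y \<in> {-1, 1}\<close>.
\<close>

definition l0norm :: "real ^ 'p \<Rightarrow> nat" where
  "l0norm w = card {j. w $ j \<noteq> 0}"

definition sparse_set :: "nat \<Rightarrow> (real ^ 'p) set" where
  "sparse_set k = {s. (\<forall>j. s $ j \<in> {0, 1}) \<and> (\<Sum>j\<in>UNIV. s $ j) \<le> real k}"

definition support_vec :: "real ^ 'p \<Rightarrow> real ^ 'p" where
  "support_vec w = (\<chi> j. if w $ j \<noteq> 0 then 1 else 0)"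

definition primal_obj ::
  "(real \<Rightarrow> real \<Rightarrow> real) \<Rightarrow> real \<Rightarrow> ('n::finite \<Rightarrow> real ^ 'p) \<Rightarrow> ('n \<Rightarrow> real)
    \<Rightarrow> (real ^ 'p) \<times> real \<Rightarrow> real" where
  "primal_obj loss \<gamma> x y =
     (\<lambda>(w, b). (\<Sum>i\<in>UNIV. loss (y i) (w \<bullet> x i + b)) + 1 / (2 * \<gamma>) * (norm w)\<^sup>2)"

definition fenchel_conj :: "(real \<Rightarrow> real \<Rightarrow> real) \<Rightarrow> real \<Rightarrow> real \<Rightarrow> ereal" where
  "fenchel_conj loss y \<alpha> = (SUP u. ereal (u * \<alpha> - loss y u))"

text \<open>
  A Fenchel conjugate of a real-valued function never takes the value \<open>-\<infinity>\<close>, so the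
  \<^typ>\<open>ereal\<close> operations below involve no \<open>\<infinity> - \<infinity>\<close>.  The \<open>j\<close>-th column
  of the data matrix with rows \<open>x i\<close> is \<open>column j (\<chi> i. x i)\<close>.
\<close>

definition dual_obj ::
  "(real \<Rightarrow> real \<Rightarrow> real) \<Rightarrow> real \<Rightarrow> ('n::finite \<Rightarrow> real ^ 'p) \<Rightarrow> ('n \<Rightarrow> real)
    \<Rightarrow> real ^ 'n \<Rightarrow> real ^ 'p \<Rightarrow> ereal" where
  "dual_obj loss \<gamma> x y \<alpha> s =
     - (\<Sum>i\<in>UNIV. fenchel_conj loss (y i) (\<alpha> $ i))
     - ereal (\<gamma> / 2 * (\<Sum>j\<in>UNIV.
         s $ j * ((\<alpha> \<bullet> column j (\<chi> i. x i)) * (column j (\<chi> i. x i) \<bullet> \<alpha>))))"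

definition dual_value ::
  "(real \<Rightarrow> real \<Rightarrow> real) \<Rightarrow> real \<Rightarrow> ('n::finite \<Rightarrow> real ^ 'p) \<Rightarrow> ('n \<Rightarrow> real)
    \<Rightarrow> real ^ 'p \<Rightarrow> ereal" where
  "dual_value loss \<gamma> x y s =
     (SUP \<alpha> \<in> {\<alpha>. (\<Sum>i\<in>UNIV. \<alpha> $ i) = 0}. dual_obj loss \<gamma> x y \<alpha> s)"

text \<open>
  The library's \<^const>\<open>convex_on\<close> is restricted to real-valued functions; convexity of an
  extended-real-valued function means convexity of the underlying set and of its epigraph (whose
  heights are real).
\<close>

definition ereal_convex_on :: "'a::real_vector set \<Rightarrow> ('a \<Rightarrow> ereal) \<Rightarrow> bool" where
  "ereal_convex_on S f \<longleftrightarrow>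
     convex S \<and> convex {(s, t :: real). s \<in> S \<and> f s \<le> ereal t}"

end

theory Submission
  imports Defs
begin

text \<open>
  For a fixed binary \<open>s\<close>, the dual value \<open>c(s)\<close> is the infimum of the primal objective over all
  \<open>(w, b)\<close> with \<open>w\<close> supported in \<open>s\<close>.  Weak duality is Fenchel--Young together with completing the
  square in \<open>w\<close>.  For strong duality the margins \<open>w \<bullet> x i + b\<close> are perturbed by \<open>z\<close>; as the losses
  are finite everywhere, a hyperplane separating the strict epigraph of the convex perturbation
  function from the point \<open>(0, V)\<close>, where \<open>V\<close> is the primal infimum, cannot be vertical, and its
  slope is an optimal dual vector.  The equivalence follows because the \<open>k\<close>-sparse vectors are the
  union over \<open>s\<close> of the vectors supported in \<open>s\<close>, and convexity of \<open>c\<close> because it is a supremum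
  of affine functions.
\<close>

section \<open>Sums of Fenchel conjugates\<close>

text \<open>The values of \<open>u\<close> at different indices can be chosen independently, so a
  bound for all joint choices bounds the sum of the separate suprema. The induction frees one index
  at a time.\<close>

lemma sum_SUP_le_ereal:
  fixes g :: "'i \<Rightarrow> 'b \<Rightarrow> real"
  assumes "finite F" and "\<And>u. (\<Sum>i\<in>F. g i (u i)) \<le> C"
  shows "(\<Sum>i\<in>F. SUP v. ereal (g i v)) \<le> ereal C"
  using assms
proof (induction F arbitrary: C rule: finite_induct)
  case empty
  then show ?case by simp
next
  case (insert i F)
  let ?X = "\<Sum>i\<in>F. SUP v. ereal (g i v)"
  have le: "?X \<le> ereal (C - g i v)" for v
  proof (rule insert.IH)
    fix u
    have "(\<Sum>l\<in>insert i F. g l ((u(i := v)) l)) = g i v + (\<Sum>l\<in>F. g l (u l))"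
      using insert.hyps by (auto intro!: sum.cong)
    with insert.prems[of "u(i := v)"] show "(\<Sum>i\<in>F. g i (u i)) \<le> C - g i v" by simp
  qed
  \<comment> \<open>Moving \<open>?X\<close> inside the supremum in \<open>ereal\<close> requires
    that it is not minus infinity.\<close>
  have "?X \<noteq> -\<infinity>"
  proof -
    have "ereal (\<Sum>i\<in>F. g i undefined) \<le> ?X"
      unfolding sum_ereal[symmetric] by (intro sum_mono SUP_upper) auto
    then show ?thesis by auto
  qed
  then have "(SUP v. ereal (g i v)) + ?X = (SUP v. ereal (g i v) + ?X)"
    by (subst SUP_ereal_add_left) auto
  also have "\<dots> \<le> ereal C"
  proof (rule SUP_least)
    fix v
    show "ereal (g i v) + ?X \<le> ereal C"
      using le[of v] by (cases ?X) auto
  qed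
  finally show ?case using insert.hyps by simp
qed

lemma fenchel_conj_ge: "ereal (u * a - loss y u) \<le> fenchel_conj loss y a"
  unfolding fenchel_conj_def by (rule SUP_upper) simp

lemma sum_fenchel_conj_ge:
  "ereal (\<Sum>i\<in>F. u i * a i - loss (y i) (u i)) \<le> (\<Sum>i\<in>F. fenchel_conj loss (y i) (a i))"
  unfolding sum_ereal[symmetric] by (intro sum_mono fenchel_conj_ge)

lemma sum_fenchel_conj_not_MInf: "(\<Sum>i\<in>F. fenchel_conj loss (y i) (a i)) \<noteq> -\<infinity>"
  using sum_fenchel_conj_ge[of "\<lambda>_. 0" a loss y F] by auto

section \<open>The quadratic term of the dual\<close>

text \<open>This is the transposed data matrix applied to \<alpha>.\<close>

definition data_comb :: "('n::finite \<Rightarrow> real ^ 'p) \<Rightarrow> real ^ 'n \<Rightarrow> real ^ 'p" where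
  "data_comb x \<alpha> = (\<Sum>i\<in>UNIV. \<alpha> $ i *\<^sub>R x i)"

lemma inner_column_eq: "\<alpha> \<bullet> column j (\<chi> i. x i) = data_comb x \<alpha> $ j"
  by (simp add: data_comb_def inner_vec_def column_def)

lemma dual_obj_eq:
  "dual_obj loss \<gamma> x y \<alpha> s =
     - (\<Sum>i\<in>UNIV. fenchel_conj loss (y i) (\<alpha> $ i))
     - ereal (\<gamma> / 2 * (\<Sum>j\<in>UNIV. s $ j * (data_comb x \<alpha> $ j)\<^sup>2))"
  unfolding dual_obj_def inner_commute[of "column _ _"] inner_column_eq
  by (simp add: power2_eq_square)

text \<open>Once the entries of \<alpha> sum to zero, the intercept \<open>b\<close> drops
  out.\<close>

lemma sum_margins:
  "(\<Sum>i\<in>UNIV. \<alpha> $ i * (w \<bullet> x i + b)) = w \<bullet> data_comb x \<alpha> + b * (\<Sum>i\<in>UNIV. \<alpha> $ i)"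
  by (simp add: data_comb_def inner_sum_right sum_distrib_left sum.distrib algebra_simps)

lemma norm_vec_sq: "(norm (w :: real ^ 'p))\<^sup>2 = (\<Sum>j\<in>UNIV. (w $ j)\<^sup>2)"
  unfolding power2_norm_eq_inner inner_vec_def by (simp add: power2_eq_square)

text \<open>Coordinatewise, the gap is the square
  \<open>(w $ j + \<gamma> * r $ j)\<^sup>2 / (2 * \<gamma>)\<close> where \<open>s $ j = 1\<close>;
  both sides vanish where \<open>s $ j = 0\<close>.\<close>

lemma quadratic_lower_bound:
  fixes w r s :: "real ^ 'p"
  assumes "\<gamma> > 0" and s: "\<And>j. s $ j \<in> {0, 1}" and w: "\<And>j. s $ j = 0 \<Longrightarrow> w $ j = 0"
  shows "- (\<gamma> / 2 * (\<Sum>j\<in>UNIV. s $ j * (r $ j)\<^sup>2)) \<le> w \<bullet> r + 1 / (2 * \<gamma>) * (norm w)\<^sup>2"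
proof -
  have "- (\<gamma> / 2 * (s $ j * (r $ j)\<^sup>2)) \<le> w $ j * r $ j + 1 / (2 * \<gamma>) * (w $ j)\<^sup>2" for j
  proof (cases "s $ j = 0")
    case True
    then show ?thesis using w by simp
  next
    case False
    then have "s $ j = 1" using s[of j] by simp
    moreover have "0 \<le> (w $ j + \<gamma> * r $ j)\<^sup>2 / (2 * \<gamma>)" using \<open>\<gamma> > 0\<close> by simp
    moreover have "(w $ j + \<gamma> * r $ j)\<^sup>2 / (2 * \<gamma>)
        = w $ j * r $ j + 1 / (2 * \<gamma>) * (w $ j)\<^sup>2 + \<gamma> / 2 * (r $ j)\<^sup>2"
      using \<open>\<gamma> > 0\<close> by (simp add: field_simps power2_eq_square)
    ultimately show ?thesis by simp
  qed
  then have "(\<Sum>j\<in>UNIV. - (\<gamma> / 2 * (s $ j * (r $ j)\<^sup>2)))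
      \<le> (\<Sum>j\<in>UNIV. w $ j * r $ j + 1 / (2 * \<gamma>) * (w $ j)\<^sup>2)"
    by (intro sum_mono) auto
  then show ?thesis
    unfolding norm_vec_sq inner_vec_def
    by (simp add: sum.distrib sum_distrib_left sum_negf)
qed

text \<open>This \<open>w\<close> makes the completed square vanish on the support of
  \<open>s\<close>; binary entries equal their own squares.\<close>

lemma quadratic_lower_bound_attained:
  fixes r s :: "real ^ 'p"
  assumes "\<gamma> > 0" and s: "\<And>j. s $ j \<in> {0, 1}" and w_def: "w = (\<chi> j. - \<gamma> * s $ j * r $ j)"
  shows "w \<bullet> r + 1 / (2 * \<gamma>) * (norm w)\<^sup>2 = - (\<gamma> / 2 * (\<Sum>j\<in>UNIV. s $ j * (r $ j)\<^sup>2))"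
proof -
  have "w $ j * r $ j + 1 / (2 * \<gamma>) * (w $ j)\<^sup>2 = - (\<gamma> / 2 * (s $ j * (r $ j)\<^sup>2))" for j
    using s[of j] \<open>\<gamma> > 0\<close> by (auto simp: w_def field_simps power2_eq_square)
  then have "(\<Sum>j\<in>UNIV. w $ j * r $ j + 1 / (2 * \<gamma>) * (w $ j)\<^sup>2)
      = (\<Sum>j\<in>UNIV. - (\<gamma> / 2 * (s $ j * (r $ j)\<^sup>2)))"
    by (intro sum.cong) auto
  then show ?thesis
    unfolding norm_vec_sq inner_vec_def
    by (simp add: sum.distrib sum_distrib_left sum_negf)
qed

section \<open>Weak duality for a fixed support\<close>

definition supported :: "real ^ 'p \<Rightarrow> ((real ^ 'p) \<times> real) set" where
  "supported s = {(w, b). \<forall>j. s $ j = 0 \<longrightarrow> w $ j = 0}"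

lemma weak_duality:
  fixes x :: "'n::finite \<Rightarrow> real ^ 'p"
  assumes "\<gamma> > 0" and s: "\<And>j. s $ j \<in> {0, 1}" and wb: "(w, b) \<in> supported s"
  shows "dual_value loss \<gamma> x y s \<le> ereal (primal_obj loss \<gamma> x y (w, b))"
  unfolding dual_value_def
proof (rule SUP_least)
  fix \<alpha> :: "real ^ 'n" assume "\<alpha> \<in> {\<alpha>. (\<Sum>i\<in>UNIV. \<alpha> $ i) = 0}"
  then have sum0: "(\<Sum>i\<in>UNIV. \<alpha> $ i) = 0" by simp
  let ?F = "\<Sum>i\<in>UNIV. fenchel_conj loss (y i) (\<alpha> $ i)"
  let ?m = "\<lambda>i. w \<bullet> x i + b"
  \<comment> \<open>Fenchel--Young, with the margins of \<open>(w, b)\<close> as the points.\<close>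
  have "ereal ((\<Sum>i\<in>UNIV. \<alpha> $ i * ?m i) - (\<Sum>i\<in>UNIV. loss (y i) (?m i))) \<le> ?F"
    using sum_fenchel_conj_ge[of ?m "($) \<alpha>" loss y UNIV]
    by (simp add: sum_subtractf mult.commute)
  moreover have "- (\<gamma> / 2 * (\<Sum>j\<in>UNIV. s $ j * (data_comb x \<alpha> $ j)\<^sup>2))
      \<le> w \<bullet> data_comb x \<alpha> + 1 / (2 * \<gamma>) * (norm w)\<^sup>2"
    using quadratic_lower_bound[OF \<open>\<gamma> > 0\<close> s] wb by (auto simp: supported_def)
  \<comment> \<open>If \<open>?F\<close> is infinite, the dual objective is minus infinity and the
    claim is trivial.\<close>
  ultimately show "dual_obj loss \<gamma> x y \<alpha> s \<le> ereal (primal_obj loss \<gamma> x y (w, b))"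
    unfolding dual_obj_eq primal_obj_def sum_margins sum0
    by (cases ?F) auto
qed

section \<open>Perturbed margins and strong duality\<close>

lemma convex_on_norm_sq: "convex_on UNIV (\<lambda>w :: 'a::real_normed_vector. (norm w)\<^sup>2)"
proof (rule convex_onI)
  fix t :: real and a b :: 'a assume "0 < t" "t < 1"
  then have "norm ((1 - t) *\<^sub>R a + t *\<^sub>R b) \<le> (1 - t) * norm a + t * norm b"
    by (intro norm_triangle_le) simp
  then have "(norm ((1 - t) *\<^sub>R a + t *\<^sub>R b))\<^sup>2 \<le> ((1 - t) * norm a + t * norm b)\<^sup>2"
    by (intro power_mono) auto
  also have "\<dots> \<le> (1 - t) * (norm a)\<^sup>2 + t * (norm b)\<^sup>2"
    using convex_onD[OF convex_power2, of t "norm a" "norm b"] \<open>0 < t\<close> \<open>t < 1\<close> by simp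
  finally show "(norm ((1 - t) *\<^sub>R a + t *\<^sub>R b))\<^sup>2 \<le> (1 - t) * (norm a)\<^sup>2 + t * (norm b)\<^sup>2" .
qed simp

text \<open>For \<open>z = 0\<close>, \<open>c = 1 / (2 * \<gamma>)\<close> and
  \<open>g i = loss (y i)\<close> this is the primal objective.\<close>

definition perturbed_obj ::
  "('n::finite \<Rightarrow> real \<Rightarrow> real) \<Rightarrow> real \<Rightarrow> ('n \<Rightarrow> real ^ 'p)
    \<Rightarrow> real ^ 'n \<Rightarrow> real ^ 'p \<Rightarrow> real \<Rightarrow> real" where
  "perturbed_obj g c x z w b = (\<Sum>i\<in>UNIV. g i (z $ i + w \<bullet> x i + b)) + c * (norm w)\<^sup>2"

text \<open>The shifted margins are linear in \<open>(z, w, b)\<close> jointly, so convexity of each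
  \<open>g i\<close> and of the squared norm carries over.\<close>

lemma perturbed_obj_convex:
  assumes g: "\<And>i. convex_on UNIV (g i)" and "c \<ge> 0" "0 \<le> u" "0 \<le> v" "u + v = 1"
  shows "perturbed_obj g c x (u *\<^sub>R z + v *\<^sub>R z') (u *\<^sub>R w + v *\<^sub>R w') (u * b + v * b')
    \<le> u * perturbed_obj g c x z w b + v * perturbed_obj g c x z' w' b'"
proof -
  \<comment> \<open>The point type stays general: the fact serves both for the losses on reals and
    for the squared norm on vectors.\<close>
  have *: "f (u *\<^sub>R p + v *\<^sub>R q) \<le> u * f p + v * f q" if "convex_on UNIV f"
    for f :: "'z::real_vector \<Rightarrow> real" and p q
    using that assms by (auto simp: convex_on_def)
  have "(\<Sum>i\<in>UNIV. g i ((u *\<^sub>R z + v *\<^sub>R z') $ i + (u *\<^sub>R w + v *\<^sub>R w') \<bullet> x i + (u * b + v * b')))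
      = (\<Sum>i\<in>UNIV. g i (u *\<^sub>R (z $ i + w \<bullet> x i + b) + v *\<^sub>R (z' $ i + w' \<bullet> x i + b')))"
    by (simp add: inner_add_left algebra_simps)
  also have "\<dots> \<le> (\<Sum>i\<in>UNIV. u * g i (z $ i + w \<bullet> x i + b) + v * g i (z' $ i + w' \<bullet> x i + b'))"
    by (intro sum_mono * g)
  also have "\<dots> = u * (\<Sum>i\<in>UNIV. g i (z $ i + w \<bullet> x i + b))
      + v * (\<Sum>i\<in>UNIV. g i (z' $ i + w' \<bullet> x i + b'))"
    by (simp add: sum.distrib sum_distrib_left)
  finally have "(\<Sum>i\<in>UNIV. g i ((u *\<^sub>R z + v *\<^sub>R z') $ i + (u *\<^sub>R w + v *\<^sub>R w') \<bullet> x i + (u * b + v * b')))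
      \<le> \<dots>" .
  moreover have "c * (norm (u *\<^sub>R w + v *\<^sub>R w'))\<^sup>2 \<le> c * (u * (norm w)\<^sup>2 + v * (norm w')\<^sup>2)"
    by (intro mult_left_mono *[OF convex_on_norm_sq] \<open>c \<ge> 0\<close>)
  ultimately show ?thesis
    unfolding perturbed_obj_def by (simp add: algebra_simps)
qed

text \<open>When \<open>V\<close> is the infimum at \<open>z = 0\<close>, \<alpha> is a subgradient
  there of the infimum over \<open>(w, b)\<close> as a function of \<open>z\<close>.\<close>

lemma perturbation_subgradient:
  fixes x :: "'n::finite \<Rightarrow> real ^ 'p"
  assumes g: "\<And>i. convex_on UNIV (g i)" and "c \<ge> 0"
    and V: "\<And>w b. (w, b) \<in> supported s \<Longrightarrow> V \<le> perturbed_obj g c x 0 w b"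
  obtains \<alpha> where
    "\<And>z w b. (w, b) \<in> supported s \<Longrightarrow> V + \<alpha> \<bullet> z \<le> perturbed_obj g c x z w b"
proof -
  \<comment> \<open>The strict inequality keeps \<open>(0, V)\<close> out of \<open>S\<close>, even
    if the infimum is attained.\<close>
  define S where "S = {(z, t). \<exists>w b. (w, b) \<in> supported s \<and> perturbed_obj g c x z w b < t}"
  have "convex S"
    unfolding convex_def
  proof (intro ballI allI impI)
    fix p q :: "(real ^ 'n) \<times> real" and u v :: real
    assume "p \<in> S" "q \<in> S" and uv: "0 \<le> u" "0 \<le> v" "u + v = 1"
    obtain z t z' t' where pq: "p = (z, t)" "q = (z', t')" by (cases p, cases q)
    obtain w b w' b' where 1: "(w, b) \<in> supported s" "perturbed_obj g c x z w b < t"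
      and 2: "(w', b') \<in> supported s" "perturbed_obj g c x z' w' b' < t'"
      using \<open>p \<in> S\<close> \<open>q \<in> S\<close> unfolding S_def pq by auto
    have "(u *\<^sub>R w + v *\<^sub>R w', u * b + v * b') \<in> supported s"
      using 1(1) 2(1) by (auto simp: supported_def)
    moreover have "u * perturbed_obj g c x z w b + v * perturbed_obj g c x z' w' b' < u * t + v * t'"
    \<comment> \<open>Multiplying by \<open>u = 0\<close> would lose strictness; then
      \<open>v = 1\<close> and the second point supplies it.\<close>
    proof (cases "u = 0")
      case True
      then show ?thesis using 2(2) uv by simp
    next
      case False
      then have "u * perturbed_obj g c x z w b < u * t" using 1(2) uv by simp
      moreover have "v * perturbed_obj g c x z' w' b' \<le> v * t'"
        using 2(2) uv by (intro mult_left_mono) auto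
      ultimately show ?thesis by simp
    qed
    ultimately show "u *\<^sub>R p + v *\<^sub>R q \<in> S"
      using perturbed_obj_convex[where g = g and x = x and z = z and z' = z' and w = w and w' = w'
          and b = b and b' = b', OF g \<open>c \<ge> 0\<close> uv]
      unfolding S_def pq by fastforce
  qed
  moreover have mem: "(z, perturbed_obj g c x z w b + d) \<in> S"
    if "(w, b) \<in> supported s" "d > 0" for z w b d
    unfolding S_def using that by (auto intro!: exI[of _ w] exI[of _ b])
  have zero: "(0, 0) \<in> supported s" by (simp add: supported_def)
  have "S \<noteq> {}" using mem[OF zero zero_less_one] by blast
  moreover have "S \<inter> {(0, V)} = {}"
    using V by (fastforce simp: S_def)
  ultimately have "\<exists>a \<beta>. a \<noteq> 0 \<and> (\<forall>p\<in>{(0, V)}. a \<bullet> p \<le> \<beta>) \<and> (\<forall>p\<in>S. \<beta> \<le> a \<bullet> p)"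
    by (intro separating_hyperplane_sets) (simp_all add: Int_commute)
  then obtain a \<beta> where "a \<noteq> 0" and
    a: "a \<bullet> (0, V) \<le> \<beta>" "\<And>p. p \<in> S \<Longrightarrow> \<beta> \<le> a \<bullet> p"
    by blast
  obtain a1 a2 where a_eq: "a = (a1, a2)" by (cases a)
  have sep: "a2 * V \<le> a1 \<bullet> z + a2 * (perturbed_obj g c x z w b + d)"
    if "(w, b) \<in> supported s" "d > 0" for z w b d
    using a(1) a(2)[OF mem[OF that, of z]] by (simp add: a_eq)
  \<comment> \<open>\<open>S\<close> is unbounded upwards above \<open>z = 0\<close>; the point at
    height \<open>V + D + 1\<close> already rules out a negative \<open>a2\<close>.\<close>
  have "a2 \<ge> 0"
  proof (rule ccontr)
    assume "\<not> a2 \<ge> 0"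
    define D where "D = perturbed_obj g c x 0 0 0 - V"
    have "D \<ge> 0" using V[OF zero] by (simp add: D_def)
    have "0 \<le> a2 * (D + 1)"
      using sep[OF zero, of 1 0] by (simp add: D_def algebra_simps)
    moreover have "a2 * (D + 1) < 0"
      using \<open>\<not> a2 \<ge> 0\<close> \<open>D \<ge> 0\<close> by (intro mult_neg_pos) auto
    ultimately show False by simp
  qed
  moreover have "a2 \<noteq> 0"
  proof
    assume "a2 = 0"
    then have "0 \<le> a1 \<bullet> (- a1)" using sep[OF zero zero_less_one, of "- a1"] by simp
    then have "a1 = 0" by (metis inner_gt_zero_iff inner_minus_right neg_0_le_iff_le not_less)
    then show False using \<open>a \<noteq> 0\<close> \<open>a2 = 0\<close> by (simp add: a_eq zero_prod_def)
  qed
  ultimately have "a2 > 0" by simp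
  \<comment> \<open>Divide by \<open>a2\<close> and let the excess height \<open>d\<close> tend to
    zero.\<close>
  have "V + (- (1 / a2) *\<^sub>R a1) \<bullet> z \<le> perturbed_obj g c x z w b"
    if "(w, b) \<in> supported s" for z w b
  proof (rule field_le_epsilon)
    fix d :: real assume "d > 0"
    from sep[OF that this, of z] \<open>a2 > 0\<close>
    show "V + (- (1 / a2) *\<^sub>R a1) \<bullet> z \<le> perturbed_obj g c x z w b + d"
      by (simp add: field_simps)
  qed
  then show thesis by (rule that)
qed

text \<open>The subgradient \<alpha> is a dual vector of value at least \<open>V\<close>: varying
  \<open>b\<close> gives feasibility, the best \<open>w\<close> produces the quadratic term, and
  varying the margins produces the conjugates.\<close>

lemma strong_duality_finite:
  fixes x :: "'n::finite \<Rightarrow> real ^ 'p"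
  assumes "\<gamma> > 0" and s: "\<And>j. s $ j \<in> {0, 1}"
    and conv: "\<And>i. convex_on UNIV (loss (y i))"
    and V: "\<And>w b. (w, b) \<in> supported s \<Longrightarrow> V \<le> primal_obj loss \<gamma> x y (w, b)"
  shows "ereal V \<le> dual_value loss \<gamma> x y s"
proof -
  let ?P = "perturbed_obj (\<lambda>i. loss (y i)) (1 / (2 * \<gamma>)) x"
  have "V \<le> ?P 0 w b" if "(w, b) \<in> supported s" for w b
    using V[OF that] by (simp add: perturbed_obj_def primal_obj_def)
  then obtain \<alpha> where
    \<alpha>: "\<And>z w b. (w, b) \<in> supported s \<Longrightarrow> V + \<alpha> \<bullet> z \<le> ?P z w b"
    using perturbation_subgradient[of "\<lambda>i. loss (y i)" "1 / (2 * \<gamma>)" s V x] conv \<open>\<gamma> > 0\<close> by auto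
  let ?r = "data_comb x \<alpha>"
  \<comment> \<open>The same inequality with the perturbed margin \<open>u\<close> instead of \<open>z\<close> as the free variable.\<close>
  have bound: "V + (\<Sum>i\<in>UNIV. \<alpha> $ i * u i) - (w \<bullet> ?r + b * (\<Sum>i\<in>UNIV. \<alpha> $ i))
      \<le> (\<Sum>i\<in>UNIV. loss (y i) (u i)) + 1 / (2 * \<gamma>) * (norm w)\<^sup>2"
    if "(w, b) \<in> supported s" for u w b
  proof -
    have "\<alpha> \<bullet> (\<chi> i. u i - (w \<bullet> x i + b))
        = (\<Sum>i\<in>UNIV. \<alpha> $ i * u i) - (w \<bullet> ?r + b * (\<Sum>i\<in>UNIV. \<alpha> $ i))"
      unfolding sum_margins[symmetric] by (simp add: inner_vec_def right_diff_distrib sum_subtractf)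
    then show ?thesis
      using \<alpha>[OF that, of "\<chi> i. u i - (w \<bullet> x i + b)"] by (simp add: perturbed_obj_def algebra_simps)
  qed
  \<comment> \<open>At zero \<open>w\<close> and zero margins, \<open>bound\<close> bounds a linear
    function of \<open>b\<close> by \<open>D\<close>; the chosen \<open>b\<close> would give it the
    value \<open>D + 1\<close>.\<close>
  have sum0: "(\<Sum>i\<in>UNIV. \<alpha> $ i) = 0"
  proof (rule ccontr)
    assume ne: "(\<Sum>i\<in>UNIV. \<alpha> $ i) \<noteq> 0"
    define D where "D = (\<Sum>i\<in>UNIV. loss (y i) 0) - V"
    have "(0, b) \<in> supported s" for b by (simp add: supported_def)
    have "- (b * (\<Sum>i\<in>UNIV. \<alpha> $ i)) \<le> D" for b
      using bound[OF \<open>(0, b) \<in> supported s\<close>, of "\<lambda>_. 0"] by (simp add: D_def)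
    from this[of "- (D + 1) / (\<Sum>i\<in>UNIV. \<alpha> $ i)"] ne show False by simp
  qed
  let ?q = "\<gamma> / 2 * (\<Sum>j\<in>UNIV. s $ j * (?r $ j)\<^sup>2)"
  define w where "w = (\<chi> j. - \<gamma> * s $ j * ?r $ j)"
  have "(w, 0) \<in> supported s" by (simp add: supported_def w_def)
  note bound_w = bound[OF this]
  have "(\<Sum>i\<in>UNIV. u i * \<alpha> $ i - loss (y i) (u i)) \<le> - V - ?q" for u
    using bound_w[of u] quadratic_lower_bound_attained[OF \<open>\<gamma> > 0\<close> s w_def]
    by (simp add: sum_subtractf mult.commute)
  \<comment> \<open>The bound is uniform in \<open>u\<close>, so it survives taking the suprema
    separately.\<close>
  then have "(\<Sum>i\<in>UNIV. fenchel_conj loss (y i) (\<alpha> $ i)) \<le> ereal (- V - ?q)"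
    unfolding fenchel_conj_def
    by (intro sum_SUP_le_ereal[where g = "\<lambda>i u. u * \<alpha> $ i - loss (y i) u"]) simp_all
  then have "ereal V \<le> dual_obj loss \<gamma> x y \<alpha> s"
    unfolding dual_obj_eq
    by (cases "\<Sum>i\<in>UNIV. fenchel_conj loss (y i) (\<alpha> $ i)") auto
  also have "\<dots> \<le> dual_value loss \<gamma> x y s"
    unfolding dual_value_def using sum0 by (intro SUP_upper) simp
  finally show ?thesis .
qed

lemma strong_duality:
  fixes x :: "'n::finite \<Rightarrow> real ^ 'p"
  assumes "\<gamma> > 0" and s: "\<And>j. s $ j \<in> {0, 1}"
    and conv: "\<And>i. convex_on UNIV (loss (y i))"
  shows "dual_value loss \<gamma> x y s = (INF wb \<in> supported s. ereal (primal_obj loss \<gamma> x y wb))"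
    (is "_ = ?I")
proof (rule order.antisym)
  show "dual_value loss \<gamma> x y s \<le> ?I"
    by (rule INF_greatest) (metis weak_duality[OF \<open>\<gamma> > 0\<close> s] surj_pair)
  show "?I \<le> dual_value loss \<gamma> x y s"
  \<comment> \<open>Minus infinity is trivial, and plus infinity is impossible because
    \<open>(0, 0)\<close> is supported in \<open>s\<close> with a finite objective.\<close>
  proof (cases ?I)
    case (real V)
    have "V \<le> primal_obj loss \<gamma> x y (w, b)" if "(w, b) \<in> supported s" for w b
      using INF_lower[OF that, of "\<lambda>wb. ereal (primal_obj loss \<gamma> x y wb)"] real by simp
    from strong_duality_finite[OF \<open>\<gamma> > 0\<close> s conv this] show ?thesis
      using real by simp
  next
    case PInf
    have "(0, 0) \<in> supported s" by (simp add: supported_def)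
    from INF_lower[OF this, of "\<lambda>wb. ereal (primal_obj loss \<gamma> x y wb)"] PInf show ?thesis by simp
  qed simp
qed

section \<open>Convexity of the dual value\<close>

text \<open>The epigraph of a supremum is the intersection of the epigraphs
  \<open>E \<alpha>\<close>. Each is a half-space, or the whole space when a conjugate is
  infinite.\<close>

lemma dual_value_convex:
  fixes x :: "'n::finite \<Rightarrow> real ^ 'p"
  assumes "convex S"
  shows "ereal_convex_on S (dual_value loss \<gamma> x y)"
proof -
  let ?A = "{\<alpha> :: real ^ 'n. (\<Sum>i\<in>UNIV. \<alpha> $ i) = 0}"
  define E where "E \<alpha> = {(s, t :: real). dual_obj loss \<gamma> x y \<alpha> s \<le> ereal t}" for \<alpha>
  have "convex (E \<alpha>)" for \<alpha>
  proof (cases "\<Sum>i\<in>UNIV. fenchel_conj loss (y i) (\<alpha> $ i)")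
    case (real F)
    define L where "L s = \<gamma> / 2 * (\<Sum>j\<in>UNIV. s $ j * (data_comb x \<alpha> $ j)\<^sup>2)" for s :: "real ^ 'p"
    have L: "L (u *\<^sub>R p + v *\<^sub>R q) = u * L p + v * L q" for u v p q
      by (simp add: L_def sum.distrib sum_distrib_left algebra_simps)
    have E_eq: "E \<alpha> = {(s, t). - F \<le> L s + t}"
      unfolding E_def dual_obj_eq real L_def by (auto simp: algebra_simps)
    show ?thesis
      unfolding convex_def E_eq
    proof (clarsimp simp: L)
      fix p q t t' and u v :: real
      assume "- F \<le> L p + t" "- F \<le> L q + t'" and uv: "0 \<le> u" "0 \<le> v" "u + v = 1"
      then have "u * (- F) + v * (- F) \<le> u * (L p + t) + v * (L q + t')"
        by (intro add_mono mult_left_mono) auto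
      moreover have "u * (- F) + v * (- F) = - F"
        using uv(3) by (metis distrib_right mult_1)
      ultimately show "- F \<le> u * L p + v * L q + (u * t + v * t')"
        by (simp add: algebra_simps)
    qed
  next
    case PInf
    then have "E \<alpha> = UNIV" by (simp add: E_def dual_obj_eq)
    then show ?thesis by simp
  next
    case MInf
    then show ?thesis using sum_fenchel_conj_not_MInf by blast
  qed
  then have "convex (S \<times> UNIV \<inter> (\<Inter>\<alpha>\<in>?A. E \<alpha>))"
    by (intro convex_Int convex_INT convex_Times assms) auto
  moreover have "{(s, t :: real). s \<in> S \<and> dual_value loss \<gamma> x y s \<le> ereal t}
      = S \<times> UNIV \<inter> (\<Inter>\<alpha>\<in>?A. E \<alpha>)"
    by (auto simp: E_def dual_value_def SUP_le_iff)
  ultimately show ?thesis using assms by (simp add: ereal_convex_on_def)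
qed

section \<open>Supports, sparsity and the equivalence\<close>

lemma sum_binary_eq_card:
  fixes s :: "real ^ 'p"
  assumes "\<And>j. s $ j \<in> {0, 1}"
  shows "(\<Sum>j\<in>UNIV. s $ j) = real (card {j. s $ j \<noteq> 0})"
proof -
  have "s $ j = (if s $ j \<noteq> 0 then 1 else 0)" for j
    using assms[of j] by auto
  then have "(\<Sum>j\<in>UNIV. s $ j) = (\<Sum>j\<in>UNIV. if s $ j \<noteq> 0 then 1 else 0)"
    by (intro sum.cong refl)
  then show ?thesis by (simp add: sum.If_cases)
qed

lemma support_vec_binary: "support_vec w $ j \<in> {0, 1}"
  by (simp add: support_vec_def)

lemma support_vec_in_sparse_set: "support_vec w \<in> sparse_set k \<longleftrightarrow> l0norm w \<le> k"
  using sum_binary_eq_card[of "support_vec w", OF support_vec_binary]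
  by (simp add: sparse_set_def l0norm_def support_vec_def)

lemma in_supported_support_vec: "(w, b) \<in> supported (support_vec w)"
  by (simp add: supported_def support_vec_def)

lemma l0norm_le_if_supported:
  assumes s: "s \<in> sparse_set k" and wb: "(w, b) \<in> supported s"
  shows "l0norm w \<le> k"
proof -
  have "l0norm w \<le> card {j. s $ j \<noteq> 0}"
    using wb unfolding l0norm_def supported_def by (intro card_mono) auto
  also have "\<dots> \<le> k"
    using s sum_binary_eq_card[of s] by (simp add: sparse_set_def)
  finally show ?thesis .
qed

text \<open>This splits the sparse infimum into an outer one over \<open>s\<close> and an inner one
  over \<open>supported s\<close>. The witness for \<open>w\<close> is
  \<open>support_vec w\<close>.\<close>

lemma sparse_eq_Union_supported: "{(w, b). l0norm w \<le> k} = (\<Union>s\<in>sparse_set k. supported s)"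
proof (intro set_eqI iffI)
  fix wb :: "(real ^ 'p) \<times> real" assume "wb \<in> {(w, b). l0norm w \<le> k}"
  then show "wb \<in> (\<Union>s\<in>sparse_set k. supported s)"
    using in_supported_support_vec support_vec_in_sparse_set by blast
qed (auto intro: l0norm_le_if_supported)

theorem theorem2:
  fixes loss :: "real \<Rightarrow> real \<Rightarrow> real"
    and \<gamma> :: real
    and k :: nat
    and x :: "'n::finite \<Rightarrow> real ^ 'p"
    and y :: "'n \<Rightarrow> real"
  assumes "1 \<le> k" and "k \<le> CARD('p)"
    and "\<gamma> > 0"
    and "\<And>i. y i \<in> {-1, 1}"
    and "\<And>v. v \<in> {-1, 1} \<Longrightarrow> convex_on UNIV (loss v)"
  shows "(INF (w, b) \<in> {(w, b). l0norm w \<le> k}. ereal (primal_obj loss \<gamma> x y (w, b)))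
           = (INF s \<in> sparse_set k. dual_value loss \<gamma> x y s)
       \<and> (\<forall>w b. is_arg_min (primal_obj loss \<gamma> x y) (\<lambda>(w, b). l0norm w \<le> k) (w, b)
            \<longrightarrow> is_arg_min (dual_value loss \<gamma> x y) (\<lambda>s. s \<in> sparse_set k) (support_vec w))
       \<and> (\<forall>s. is_arg_min (dual_value loss \<gamma> x y) (\<lambda>s. s \<in> sparse_set k) s
            \<longrightarrow> (\<forall>w b. is_arg_min (primal_obj loss \<gamma> x y)
                         (\<lambda>(w, b). \<forall>j. s $ j = 0 \<longrightarrow> w $ j = 0) (w, b)
                  \<longrightarrow> is_arg_min (primal_obj loss \<gamma> x y) (\<lambda>(w, b). l0norm w \<le> k) (w, b)))
       \<and> ereal_convex_on (cbox 0 1) (dual_value loss \<gamma> x y)"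
proof -
  have binary: "\<And>j. s $ j \<in> {0, 1}" if "s \<in> sparse_set k" for s :: "real ^ 'p"
    using that by (auto simp: sparse_set_def)
  have dual: "dual_value loss \<gamma> x y s = (INF wb \<in> supported s. ereal (primal_obj loss \<gamma> x y wb))"
    if "s \<in> sparse_set k" for s
    using assms(4,5) by (intro strong_duality \<open>\<gamma> > 0\<close> binary[OF that]) auto
  have dual_le: "dual_value loss \<gamma> x y s \<le> ereal (primal_obj loss \<gamma> x y wb)"
    if "s \<in> sparse_set k" "wb \<in> supported s" for s wb
    unfolding dual[OF that(1)] using that(2) by (rule INF_lower)
  have le_dual: "ereal V \<le> dual_value loss \<gamma> x y s"
    if "s \<in> sparse_set k" "\<And>wb. wb \<in> supported s \<Longrightarrow> V \<le> primal_obj loss \<gamma> x y wb" for s V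
    unfolding dual[OF that(1)] using that(2) by (auto intro: INF_greatest)
  have "(INF (w, b) \<in> {(w, b). l0norm w \<le> k}. ereal (primal_obj loss \<gamma> x y (w, b)))
      = (INF s \<in> sparse_set k. dual_value loss \<gamma> x y s)"
    unfolding sparse_eq_Union_supported
    by (simp add: dual cong: INF_cong) (rule order.antisym; blast intro: INF_greatest INF_lower INF_lower2)
  moreover have "is_arg_min (dual_value loss \<gamma> x y) (\<lambda>s. s \<in> sparse_set k) (support_vec w)"
    if opt: "is_arg_min (primal_obj loss \<gamma> x y) (\<lambda>(w, b). l0norm w \<le> k) (w, b)" for w b
  proof -
    have mem: "support_vec w \<in> sparse_set k"
      using opt by (simp add: is_arg_min_def support_vec_in_sparse_set)
    have "dual_value loss \<gamma> x y (support_vec w) \<le> dual_value loss \<gamma> x y s"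
      if s: "s \<in> sparse_set k" for s
    proof -
      have "dual_value loss \<gamma> x y (support_vec w) \<le> ereal (primal_obj loss \<gamma> x y (w, b))"
        by (rule dual_le[OF mem in_supported_support_vec])
      \<comment> \<open>Everything supported in \<open>s\<close> is \<open>k\<close>-sparse, so the
        optimal \<open>(w, b)\<close> is at least as good.\<close>
      also have "\<dots> \<le> dual_value loss \<gamma> x y s"
        using opt l0norm_le_if_supported[OF s]
        by (intro le_dual[OF s]) (force simp: is_arg_min_def not_less)
      finally show ?thesis .
    qed
    then show ?thesis using mem by (auto simp: is_arg_min_def not_less)
  qed
  moreover have "is_arg_min (primal_obj loss \<gamma> x y) (\<lambda>(w, b). l0norm w \<le> k) (w, b)"
    if s: "is_arg_min (dual_value loss \<gamma> x y) (\<lambda>s. s \<in> sparse_set k) s"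
      and opt: "is_arg_min (primal_obj loss \<gamma> x y)
        (\<lambda>(w, b). \<forall>j. s $ j = 0 \<longrightarrow> w $ j = 0) (w, b)" for s w b
  proof -
    have mem: "s \<in> sparse_set k" using s by (simp add: is_arg_min_def)
    have opt': "is_arg_min (primal_obj loss \<gamma> x y) (\<lambda>wb. wb \<in> supported s) (w, b)"
      using opt by (simp add: supported_def)
    then have wb: "(w, b) \<in> supported s" by (simp add: is_arg_min_def)
    have "primal_obj loss \<gamma> x y (w, b) \<le> primal_obj loss \<gamma> x y (w', b')"
      if "l0norm w' \<le> k" for w' b'
    proof -
      have mem': "support_vec w' \<in> sparse_set k"
        using that by (simp add: support_vec_in_sparse_set)
      \<comment> \<open>A competitor \<open>(w', b')\<close> is compared through its own support:
        optimality of \<open>(w, b)\<close> within \<open>s\<close>, then optimality of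
        \<open>s\<close>, then weak duality.\<close>
      have "ereal (primal_obj loss \<gamma> x y (w, b)) \<le> dual_value loss \<gamma> x y s"
        using opt' by (intro le_dual[OF mem]) (auto simp: is_arg_min_def not_less)
      also have "\<dots> \<le> dual_value loss \<gamma> x y (support_vec w')"
        using s mem' by (auto simp: is_arg_min_def not_less)
      also have "\<dots> \<le> ereal (primal_obj loss \<gamma> x y (w', b'))"
        by (rule dual_le[OF mem' in_supported_support_vec])
      finally show ?thesis by simp
    qed
    then show ?thesis
      using l0norm_le_if_supported[OF mem wb] by (auto simp: is_arg_min_def not_less)
  qed
  moreover have "ereal_convex_on (cbox 0 1) (dual_value loss \<gamma> x y)"
    by (rule dual_value_convex) (rule convex_box)
  ultimately show ?thesis by blast
qed

end
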